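(* Let $X$ be real. For $v_1,\ldots,v_p\in X$ and $M,N\in\bigwedge X$, $$v_{1\cdots p}\lrcorner(MN)=\sum_{\mathbf i\in\mathcal I^p}\epsilon_{\mathbf i\mathbf i'}\,\big(v_{\mathbf i'}\lrcorner M^{\wedge|\mathbf i|}\big)(v_{\mathbf i}\lrcorner N),$$ and $$v_{1\cdots p}\wedge(MN)=\sum_{\mathbf i\in\mathcal I^p}\epsilon_{\mathbf i\mathbf i'}\,\big(\tilde v_{\mathbf i}\lrcorner M^{\wedge|\mathbf i'|}\big)(v_{\mathbf i'}\wedge N),$$ where juxtaposition of multivectors is the Clifford geometric product and $M^{\wedge k}$ denotes the result of applying the grade involution $k$ times to $M$ (not an exterior power).
   Context: $X$ is a finite-dimensional real Euclidean space with inner product $\langle\cdot,\cdot\rangle$. $\bigwedge X$ is its exterior algebra, with inner product given by $\langle v_1\wedge\cdots\wedge v_p,w_1\wedge\cdots\wedge w_p\rangle=\det(\langle v_i,w_j\rangle)$, distinct grades orthogonal, product of scalars for scalars, extended bilinearly. The left contraction $M\lrcorner N$ is the unique element with $\langle L,M\lrcorner N\rangle=\langle M\wedge L,N\rangle$ for all $L\in\bigwedge X$. The Clifford geometric product $MN$ is the bilinear associative product on $\bigwedge X$ (with unit $1$) such that $vv=\|v\|^2$ for $v\in X$ and $v_1v_2\cdots v_p=v_1\wedge v_2\wedge\cdots\wedge v_p$ for orthogonal $v_1,\dots,v_p\in X$. Grade involution: linear with $\hat M=(-1)^kM$ for $M\in\bigwedge^kX$; $M^{\wedge k}$ is the composition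 of $k$ grade involutions applied to $M$. Reversion: linear with $\tilde M=(-1)^{k(k-1)/2}M$ for $M\in\bigwedge^kX$; $\tilde v_{\mathbf i}$ is the reversion of $v_{\mathbf i}$. Multi-indices: $\mathcal I^p$ is the set of all strictly increasing tuples $\mathbf i=(i_1,\dots,i_k)$, $0\le k\le p$, with entries in $\{1,\dots,p\}$ (including the empty tuple $\emptyset$); $|\mathbf i|=k$; $\mathbf i'$ is the increasing tuple of the elements of $\{1,\dots,p\}$ not in $\mathbf i$; $\epsilon_{\mathbf i\mathbf i'}$ is the sign of the permutation that puts the concatenation $\mathbf i\mathbf i'$ in increasing order. $v_{\mathbf i}=v_{i_1}\wedge\cdots\wedge v_{i_k}$ (exterior product), $v_\emptyset=1$, $v_{1\cdots p}=v_1\wedge\cdots\wedge v_p$. *)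

theory Defs
  imports
    "HOL-Analysis.Linear_Algebra"
    "HOL-Combinatorics.Permutations"
    "Jordan_Normal_Form.Determinant"
begin

section \<open>The exterior algebra\<close>

text \<open>
  The exterior algebra of a real vector space \<open>X\<close> is the associative unital real algebra generated
  by \<open>X\<close> subject to linearity of \<open>X \<rightarrow> \<And>X\<close> and to \<open>v \<and> v = 0\<close>. It is built here from formal
  algebra expressions over \<open>X\<close>, modulo the least congruence which contains the laws of such an algebra
  and these relations. Scalar multiplication is multiplication with \<open>Scal r\<close>.
  The universal property is \<open>exterior_universal\<close> below.
\<close>

datatype 'a ext_term =
  Scal real | Vec 'a | Add "'a ext_term" "'a ext_term" | Wdg "'a ext_term" "'a ext_term"

inductive ext_eq :: "'a::real_vector ext_term \<Rightarrow> 'a ext_term \<Rightarrow> bool" where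
  refl: "ext_eq s s"
| sym: "ext_eq s t \<Longrightarrow> ext_eq t s"
| trans: "ext_eq s t \<Longrightarrow> ext_eq t u \<Longrightarrow> ext_eq s u"
| add_cong: "ext_eq s s' \<Longrightarrow> ext_eq t t' \<Longrightarrow> ext_eq (Add s t) (Add s' t')"
| wdg_cong: "ext_eq s s' \<Longrightarrow> ext_eq t t' \<Longrightarrow> ext_eq (Wdg s t) (Wdg s' t')"
| add_assoc: "ext_eq (Add (Add s t) u) (Add s (Add t u))"
| add_comm: "ext_eq (Add s t) (Add t s)"
| add_zero: "ext_eq (Add (Scal 0) s) s"
| wdg_assoc: "ext_eq (Wdg (Wdg s t) u) (Wdg s (Wdg t u))"
| wdg_zero: "ext_eq (Wdg (Scal 0) s) (Scal 0)"
| wdg_one: "ext_eq (Wdg (Scal 1) s) s"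
| scal_central: "ext_eq (Wdg (Scal r) s) (Wdg s (Scal r))"
| distrib_left: "ext_eq (Wdg s (Add t u)) (Add (Wdg s t) (Wdg s u))"
| distrib_right: "ext_eq (Wdg (Add s t) u) (Add (Wdg s u) (Wdg t u))"
| scal_add: "ext_eq (Scal (a + b)) (Add (Scal a) (Scal b))"
| scal_mult: "ext_eq (Scal (a * b)) (Wdg (Scal a) (Scal b))"
| vec_add: "ext_eq (Vec (x + y)) (Add (Vec x) (Vec y))"
| vec_scale: "ext_eq (Vec (a *\<^sub>R x)) (Wdg (Scal a) (Vec x))"
| alternating: "ext_eq (Wdg (Vec x) (Vec x)) (Scal 0)"

quotient_type (overloaded) 'a multivector = "'a::real_vector ext_term" / ext_eq
proof (rule equivpI)
  show "reflp (ext_eq :: 'a ext_term \<Rightarrow> _)" by (auto intro: reflpI ext_eq.refl)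
  show "symp (ext_eq :: 'a ext_term \<Rightarrow> _)" by (auto intro: sympI ext_eq.sym)
  show "transp (ext_eq :: 'a ext_term \<Rightarrow> _)" by (auto intro: transpI ext_eq.trans)
qed

lift_definition wedge :: "'a::real_vector multivector \<Rightarrow> 'a multivector \<Rightarrow> 'a multivector"
  (infix \<open>\<^bold>\<and>\<close> 75) is Wdg
  by (rule ext_eq.wdg_cong)

lift_definition vec_mv :: "'a::real_vector \<Rightarrow> 'a multivector" is Vec .

instantiation multivector :: (real_vector) "{real_vector, one}"
begin

lift_definition zero_multivector :: "'a multivector" is "Scal 0" .
lift_definition one_multivector :: "'a multivector" is "Scal 1" .
lift_definition plus_multivector :: "'a multivector \<Rightarrow> 'a multivector \<Rightarrow> 'a multivector" is Add
  by (rule ext_eq.add_cong)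
lift_definition scaleR_multivector :: "real \<Rightarrow> 'a multivector \<Rightarrow> 'a multivector"
  is "\<lambda>a. Wdg (Scal a)"
  by (rule ext_eq.wdg_cong[OF ext_eq.refl])
lift_definition uminus_multivector :: "'a multivector \<Rightarrow> 'a multivector"
  is "Wdg (Scal (- 1))"
  by (rule ext_eq.wdg_cong[OF ext_eq.refl])
definition minus_multivector :: "'a multivector \<Rightarrow> 'a multivector \<Rightarrow> 'a multivector"
  where "minus_multivector M N = M + - N"

instance
proof
  fix a b c :: "'a multivector" and r s :: real
  show "a + b + c = a + (b + c)" by transfer (rule ext_eq.add_assoc)
  show "a + b = b + a" by transfer (rule ext_eq.add_comm)
  show "0 + a = a" by transfer (rule ext_eq.add_zero)
  show "- a + a = 0"
  proof transfer
    fix t :: "'a ext_term"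
    have "ext_eq (Add (Wdg (Scal (- 1)) t) t) (Add (Wdg (Scal (- 1)) t) (Wdg (Scal 1) t))"
      by (intro ext_eq.add_cong ext_eq.refl ext_eq.sym[OF ext_eq.wdg_one])
    moreover have "ext_eq \<dots> (Wdg (Add (Scal (- 1)) (Scal 1)) t)"
      by (rule ext_eq.sym[OF ext_eq.distrib_right])
    moreover have "ext_eq \<dots> (Wdg (Scal (- 1 + 1)) t)"
      by (intro ext_eq.wdg_cong ext_eq.refl ext_eq.sym[OF ext_eq.scal_add])
    moreover have "ext_eq \<dots> (Scal 0)" using ext_eq.wdg_zero by simp
    ultimately show "ext_eq (Add (Wdg (Scal (- 1)) t) t) (Scal 0)"
      by (meson ext_eq.trans)
  qed
  show "a - b = a + - b" by (rule minus_multivector_def)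
  show "r *\<^sub>R (a + b) = r *\<^sub>R a + r *\<^sub>R b" by transfer (rule ext_eq.distrib_left)
  show "(r + s) *\<^sub>R a = r *\<^sub>R a + s *\<^sub>R a"
    by transfer (meson ext_eq.trans ext_eq.wdg_cong ext_eq.refl ext_eq.scal_add ext_eq.distrib_right)
  show "r *\<^sub>R s *\<^sub>R a = (r * s) *\<^sub>R a"
    by transfer (meson ext_eq.trans ext_eq.sym ext_eq.wdg_cong ext_eq.refl ext_eq.scal_mult ext_eq.wdg_assoc)
  show "1 *\<^sub>R a = a" by transfer (rule ext_eq.wdg_one)
qed

end

lemma wedge_assoc: "(L \<^bold>\<and> M) \<^bold>\<and> N = L \<^bold>\<and> (M \<^bold>\<and> N)"
  by transfer (rule ext_eq.wdg_assoc)

lemma wedge_one: "1 \<^bold>\<and> M = M" "M \<^bold>\<and> 1 = M"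
  by (transfer, meson ext_eq.wdg_one ext_eq.scal_central ext_eq.sym ext_eq.trans)+

lemma wedge_scaleR: "(r *\<^sub>R M) \<^bold>\<and> N = r *\<^sub>R (M \<^bold>\<and> N)" "M \<^bold>\<and> (r *\<^sub>R N) = r *\<^sub>R (M \<^bold>\<and> N)"
  by (transfer, meson ext_eq.intros)+

lemma bilinear_wedge: "bilinear (\<^bold>\<and>)"
  unfolding bilinear_def
  by (intro conjI allI linearI wedge_scaleR; transfer)
     (rule ext_eq.distrib_left ext_eq.distrib_right)+

lemma linear_vec_mv: "linear vec_mv"
  by (rule linearI; transfer) (rule ext_eq.vec_add ext_eq.vec_scale)+

lemma vec_mv_wedge_self: "vec_mv v \<^bold>\<and> vec_mv v = 0"
  by transfer (rule ext_eq.alternating)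

primrec ext_term_eval :: "('a \<Rightarrow> 'b::real_algebra_1) \<Rightarrow> 'a ext_term \<Rightarrow> 'b" where
  "ext_term_eval f (Scal r) = of_real r"
| "ext_term_eval f (Vec v) = f v"
| "ext_term_eval f (Add s t) = ext_term_eval f s + ext_term_eval f t"
| "ext_term_eval f (Wdg s t) = ext_term_eval f s * ext_term_eval f t"

lemma ext_term_eval_cong:
  assumes "linear f" "\<And>v. f v * f v = 0" "ext_eq s t"
  shows "ext_term_eval f s = ext_term_eval f t"
  using assms(3)
  by induction
     (simp_all add: assms(2) linear_add[OF assms(1)] linear_scale[OF assms(1)] algebra_simps
        flip: scaleR_conv_of_real, simp_all add: of_real_def)

theorem exterior_universal:
  fixes f :: "'a::real_vector \<Rightarrow> 'b::real_algebra_1"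
  assumes "linear f" "\<And>v. f v * f v = 0"
  shows "\<exists>!F. linear F \<and> F 1 = 1 \<and> (\<forall>M N. F (M \<^bold>\<and> N) = F M * F N) \<and> (\<forall>v. F (vec_mv v) = f v)"
proof (rule ex1I)
  define F where "F M = ext_term_eval f (rep_multivector M)" for M
  have F: "F (abs_multivector t) = ext_term_eval f t" for t
    unfolding F_def
    by (rule ext_term_eval_cong[OF assms])
       (meson Quotient3_multivector rep_abs_rsp_left ext_eq.refl)
  have F_add: "F (M + N) = F M + F N" and F_wdg: "F (M \<^bold>\<and> N) = F M * F N"
    and F_scale: "F (r *\<^sub>R M) = r *\<^sub>R F M" for M N r
    by (induct M, induct N,
        simp add: F plus_multivector.abs_eq wedge.abs_eq scaleR_multivector.abs_eq
          scaleR_conv_of_real)+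
  show "linear F \<and> F 1 = 1 \<and> (\<forall>M N. F (M \<^bold>\<and> N) = F M * F N) \<and> (\<forall>v. F (vec_mv v) = f v)"
    by (auto intro!: linearI simp: F_add F_wdg F_scale F one_multivector_def vec_mv.abs_eq)
  fix G assume G: "linear G \<and> G 1 = 1 \<and> (\<forall>M N. G (M \<^bold>\<and> N) = G M * G N) \<and> (\<forall>v. G (vec_mv v) = f v)"
  have scal: "abs_multivector (Scal r) = r *\<^sub>R 1" for r :: real
    by transfer (metis ext_eq.scal_mult mult.right_neutral)
  have "G (abs_multivector t) = ext_term_eval f t" for t
  proof (induction t)
    case (Scal r)
    with G show ?case by (simp add: scal linear_scale of_real_def)
  next
    case (Vec v)
    with G show ?case by (simp flip: vec_mv.abs_eq)
  next
    case (Add s t)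
    with G show ?case by (simp add: linear_add flip: plus_multivector.abs_eq)
  next
    case (Wdg s t)
    with G show ?case by (simp flip: wedge.abs_eq)
  qed
  then have "G M = F M" for M by (induct M) (simp add: F)
  then show "G = F" by blast
qed

definition wedge_list :: "'a::real_vector list \<Rightarrow> 'a multivector"
  where "wedge_list vs = foldr (\<lambda>v M. vec_mv v \<^bold>\<and> M) vs 1"

definition grade :: "nat \<Rightarrow> 'a::real_vector multivector set"
  where "grade k = span {wedge_list vs | vs. length vs = k}"

text \<open>
  Here and below, \<open>THE\<close> stands for the unique such object; uniqueness and existence hold when \<open>'a\<close>
  is finite-dimensional.
\<close>

definition mv_inner :: "'a::real_inner multivector \<Rightarrow> 'a multivector \<Rightarrow> real" where
  "mv_inner = (THE B. bilinear B
     \<and> (\<forall>a b. B (a *\<^sub>R 1) (b *\<^sub>R 1) = a * b)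
     \<and> (\<forall>p vs ws. length vs = p \<longrightarrow> length ws = p \<longrightarrow>
          B (wedge_list vs) (wedge_list ws) = det (mat p p (\<lambda>(i, j). inner (vs ! i) (ws ! j))))
     \<and> (\<forall>j k. j \<noteq> k \<longrightarrow> (\<forall>M\<in>grade j. \<forall>N\<in>grade k. B M N = 0)))"

definition left_contraction ::
  "'a::real_inner multivector \<Rightarrow> 'a multivector \<Rightarrow> 'a multivector" (infix \<open>\<^bold>\<rfloor>\<close> 75) where
  "M \<^bold>\<rfloor> N = (THE K. \<forall>L. mv_inner L K = mv_inner (M \<^bold>\<and> L) N)"

definition is_geometric_product ::
  "('a::real_inner multivector \<Rightarrow> 'a multivector \<Rightarrow> 'a multivector) \<Rightarrow> bool" where
  "is_geometric_product g \<longleftrightarrow> bilinear g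
     \<and> (\<forall>L M N. g (g L M) N = g L (g M N))
     \<and> (\<forall>M. g 1 M = M \<and> g M 1 = M)
     \<and> (\<forall>v. g (vec_mv v) (vec_mv v) = (norm v)\<^sup>2 *\<^sub>R 1)
     \<and> (\<forall>vs. (\<forall>i<length vs. \<forall>j<length vs. i \<noteq> j \<longrightarrow> inner (vs ! i) (vs ! j) = 0) \<longrightarrow>
          foldr (\<lambda>v. g (vec_mv v)) vs 1 = wedge_list vs)"

definition geometric_product ::
  "'a::real_inner multivector \<Rightarrow> 'a multivector \<Rightarrow> 'a multivector" (infix \<open>\<^bold>\<cdot>\<close> 75) where
  "geometric_product = (THE g. is_geometric_product g)"

definition grade_involution :: "'a::real_vector multivector \<Rightarrow> 'a multivector" where
  "grade_involution = (THE f. linear f \<and> (\<forall>k. \<forall>M\<in>grade k. f M = (- 1) ^ k *\<^sub>R M))"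

definition reversion :: "'a::real_vector multivector \<Rightarrow> 'a multivector" where
  "reversion = (THE f. linear f \<and> (\<forall>k. \<forall>M\<in>grade k. f M = (- 1) ^ (k * (k - 1) div 2) *\<^sub>R M))"


section \<open>Multi-indices\<close>

definition multi_indices :: "nat \<Rightarrow> nat list set"
  where "multi_indices p = {is. sorted_wrt (<) is \<and> set is \<subseteq> {1..p}}"

definition mi_compl :: "nat \<Rightarrow> nat list \<Rightarrow> nat list"
  where "mi_compl p is = sorted_list_of_set ({1..p} - set is)"

text \<open>Only meant for lists without repetitions, for which the sorting permutation is unique.\<close>

definition sort_sign :: "nat list \<Rightarrow> int" where
  "sort_sign ks = sign (THE \<pi>. \<pi> permutes {..<length ks} \<and> sorted_wrt (<) (permute_list \<pi> ks))"

definition wedge_mi :: "(nat \<Rightarrow> 'a::real_vector) \<Rightarrow> nat list \<Rightarrow> 'a multivector"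
  where "wedge_mi v is = wedge_list (map v is)"

end

theory Submission
  imports Defs
begin

text \<open>
  For one vector \<open>v\<close> the two identities say that
  \<^item> \<open>v \<rfloor> (M N) = (v \<rfloor> M) N + involute M (v \<rfloor> N)\<close>, and
  \<^item> \<open>v \<and> (M N) = involute M (v \<and> N) + (v \<rfloor> M) N\<close>.

  The general case is an iteration of these (\<open>contract_wedge_mi_prod\<close>, \<open>wedge_mi_wedge_prod\<close>): each of
  the vectors \<open>v\<^sub>1, \<dots>, v\<^sub>p\<close> acts on the left or on the right factor, the multi-index records the choices,
  and the signs from the grade involution add up to the sign of sorting the concatenation of the
  multi-index and its complement.

  The contraction by a vector is the antiderivation \<open>interior v\<close>, and contractions by vectors extend to
  an action \<open>contract\<close> of the whole exterior algebra because they square to zero. The scalar part of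
  \<open>contract M N\<close> is then a bilinear form for which \<open>contract M\<close> is adjoint to \<open>L \<mapsto> M \<and> L\<close>. It is the inner
  product, by Laplace expansion of Gram determinants (\<open>mv_inner_eq\<close>). It is nondegenerate, because an
  orthonormal basis can be split off vector by vector, so \<open>contract\<close> is the left contraction
  (\<open>left_contraction_eq\<close>).

  The geometric product is obtained from the exterior product by one deformation for each vector \<open>e\<close> of
  an orthonormal basis: \<open>M \<star> N\<close> is replaced by \<open>M \<star> N + (M \<lfloor> e) \<star> (e \<rfloor> N)\<close>. Each step preserves
  associativity and the first identity (\<open>graded_product_deform\<close>). In \<open>v M\<close> and in the second identity
  each step adds the component of \<open>v\<close> along \<open>e\<close> to the vector by which \<open>M\<close> is contracted
  (\<open>deform_vec_mv\<close>, \<open>vec_mv_wedge_deform\<close>); after the last step it is \<open>v\<close> itself. So the deformed product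
  satisfies the axioms of the geometric product together with both identities. As the axioms have
  only one solution (\<open>geometric_product_unique\<close>), the identities hold for the geometric product.
\<close>

section \<open>Calculating in the exterior algebra\<close>

lemmas wedge_add = bilinear_ladd[OF bilinear_wedge] bilinear_radd[OF bilinear_wedge]
lemmas wedge_zero = bilinear_lzero[OF bilinear_wedge] bilinear_rzero[OF bilinear_wedge]
lemmas wedge_minus = bilinear_lneg[OF bilinear_wedge] bilinear_rneg[OF bilinear_wedge]
lemmas wedge_simps = wedge_add wedge_zero wedge_minus wedge_scaleR wedge_one

lemma abs_multivector_simps:
  "abs_multivector (Scal r) = r *\<^sub>R 1"
  "abs_multivector (Vec x) = vec_mv x"
  "abs_multivector (Add s t) = abs_multivector s + abs_multivector t"
  "abs_multivector (Wdg s t) = abs_multivector s \<^bold>\<and> abs_multivector t"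
  by (transfer, metis ext_eq.scal_mult mult.right_neutral)
     (simp_all add: vec_mv.abs_eq plus_multivector.abs_eq wedge.abs_eq)

lemma multivector_induct [case_names scalar vector add wedge]:
  assumes "\<And>r. P (r *\<^sub>R 1)" "\<And>x. P (vec_mv x)"
    and "\<And>M N. P M \<Longrightarrow> P N \<Longrightarrow> P (M + N)" "\<And>M N. P M \<Longrightarrow> P N \<Longrightarrow> P (M \<^bold>\<and> N)"
  shows "P M"
proof -
  have "P (abs_multivector t)" for t
    by (induction t) (simp_all add: abs_multivector_simps assms)
  then show ?thesis by (induct M) simp
qed

lemma vec_mv_anticommute: "vec_mv v \<^bold>\<and> vec_mv w = - (vec_mv w \<^bold>\<and> vec_mv v)"
proof -
  have "0 = vec_mv (v + w) \<^bold>\<and> vec_mv (v + w)"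
    by (simp add: vec_mv_wedge_self)
  also have "\<dots> = vec_mv v \<^bold>\<and> vec_mv w + vec_mv w \<^bold>\<and> vec_mv v"
    by (simp add: linear_add[OF linear_vec_mv] wedge_simps vec_mv_wedge_self)
  finally show ?thesis by (simp add: eq_neg_iff_add_eq_0)
qed

lemma vec_wedge_vec_wedge_self: "vec_mv e \<^bold>\<and> (vec_mv e \<^bold>\<and> M) = 0"
  by (simp add: vec_mv_wedge_self wedge_simps flip: wedge_assoc)

lemma vec_wedge_left_commute: "vec_mv f \<^bold>\<and> (vec_mv e \<^bold>\<and> M) = - (vec_mv e \<^bold>\<and> (vec_mv f \<^bold>\<and> M))"
  using vec_mv_anticommute[of f e] by (simp add: wedge_simps flip: wedge_assoc)

lemma wedge_list_Nil [simp]: "wedge_list [] = 1"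
  and wedge_list_Cons [simp]: "wedge_list (v # vs) = vec_mv v \<^bold>\<and> wedge_list vs"
  by (simp_all add: wedge_list_def)

lemma vec_wedge_wedge_list_member:
  "e \<in> set vs \<Longrightarrow> vec_mv e \<^bold>\<and> wedge_list vs = 0"
proof (induction vs)
  case (Cons v vs)
  then show ?case
    by (auto simp: vec_wedge_vec_wedge_self vec_wedge_left_commute[of e v] wedge_simps)
qed simp

lemma wedge_list_append: "wedge_list (vs @ ws) = wedge_list vs \<^bold>\<and> wedge_list ws"
  by (induction vs) (simp_all add: wedge_assoc wedge_simps)

text \<open>
  The vectors of a spanning set \<open>B\<close> generate the exterior algebra. All later arguments "check it on a
  basis" go through this lemma and its successor, so that no linearly independent basis of the
  exterior algebra ever has to be exhibited.
\<close>

lemma subspace_closed_under_vectors_is_UNIV: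
  assumes S: "subspace S" "1 \<in> S"
    and closed: "\<And>e M. e \<in> B \<Longrightarrow> M \<in> S \<Longrightarrow> vec_mv e \<^bold>\<and> M \<in> S"
    and B: "span B = UNIV"
  shows "S = UNIV"
proof -
  have vec: "vec_mv x \<^bold>\<and> M \<in> S" if "M \<in> S" for x M
  proof -
    have "x \<in> span B" using B by simp
    then show ?thesis
    proof (induction rule: span_induct_alt)
      case base
      then show ?case by (simp add: linear_0[OF linear_vec_mv] wedge_simps subspace_0 S)
    next
      case (step c e y)
      then show ?case
        by (simp add: linear_add[OF linear_vec_mv] linear_scale[OF linear_vec_mv] wedge_simps
            subspace_add subspace_scale S closed that)
    qed
  qed
  have "\<forall>N\<in>S. M \<^bold>\<and> N \<in> S" for M
    by (induction M rule: multivector_induct)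
       (auto simp: wedge_simps wedge_assoc vec subspace_add subspace_scale S)
  with S(2) have "M \<in> S" for M by (metis wedge_one(2))
  then show ?thesis by blast
qed

lemma span_closed_under_vectors_is_UNIV:
  assumes "1 \<in> span G" and "\<And>e M. e \<in> B \<Longrightarrow> M \<in> G \<Longrightarrow> vec_mv e \<^bold>\<and> M \<in> span G"
    and "span B = UNIV"
  shows "span G = UNIV"
proof (rule subspace_closed_under_vectors_is_UNIV[OF subspace_span assms(1) _ assms(3)])
  fix e M assume e: "e \<in> B" and "M \<in> span G"
  from this(2) show "vec_mv e \<^bold>\<and> M \<in> span G"
    by (induction rule: span_induct_alt)
       (simp_all add: wedge_simps span_zero span_add span_scale assms(2) e)
qed

lemma span_wedge_lists: "span (range (wedge_list :: 'a::real_vector list \<Rightarrow> _)) = UNIV"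
proof (rule span_closed_under_vectors_is_UNIV[where B = UNIV])
  show "1 \<in> span (range (wedge_list :: 'a list \<Rightarrow> _))"
    by (metis span_base rangeI wedge_list_Nil)
  fix e :: 'a and M :: "'a multivector" assume "M \<in> range wedge_list"
  then obtain vs where "M = wedge_list vs" by blast
  then show "vec_mv e \<^bold>\<and> M \<in> span (range wedge_list)"
    by (metis span_base rangeI wedge_list_Cons)
qed (simp add: span_UNIV)

lemma linear_eq_on_wedge_lists:
  assumes "linear f" "linear g" "\<And>vs. f (wedge_list vs) = g (wedge_list vs)"
  shows "f = g"
proof
  fix M show "f M = g M"
    by (rule linear_eq_on[OF assms(1,2), of _ "range wedge_list"])
       (auto simp: span_wedge_lists assms(3))
qed

lemma wedge_list_in_grade: "wedge_list vs \<in> grade (length vs)"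
  unfolding grade_def by (rule span_base) blast

section \<open>Grade involution and reversion\<close>

text \<open>
  Involution and reversion are defined on expressions, by recursion; since the defining relations of
  the exterior algebra are preserved by \<open>x \<mapsto> - x\<close> and by reversing all products, they descend to
  multivectors as a homomorphism and an antihomomorphism.
\<close>

lift_definition involute :: "'a::real_vector multivector \<Rightarrow> 'a multivector"
  is "rec_ext_term Scal (\<lambda>x. Vec (- x)) (\<lambda>_ _. Add) (\<lambda>_ _. Wdg)"
proof -
  fix s t :: "'a ext_term"
  let ?h = "rec_ext_term Scal (\<lambda>x. Vec (- x)) (\<lambda>_ _. Add) (\<lambda>_ _. Wdg) :: 'a ext_term \<Rightarrow> 'a ext_term"
  assume "ext_eq s t"
  then show "ext_eq (?h s) (?h t)"
    by induction
       (auto intro: ext_eq.intros ext_eq.vec_add[of "- _" "- _", simplified]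
         simp flip: scaleR_minus_right)
qed

lift_definition reverse :: "'a::real_vector multivector \<Rightarrow> 'a multivector"
  is "rec_ext_term Scal Vec (\<lambda>_ _. Add) (\<lambda>_ _ s t. Wdg t s)"
proof -
  fix s t :: "'a ext_term"
  let ?h = "rec_ext_term Scal Vec (\<lambda>_ _. Add) (\<lambda>_ _ s t. Wdg t s) :: 'a ext_term \<Rightarrow> 'a ext_term"
  assume "ext_eq s t"
  then show "ext_eq (?h s) (?h t)"
  proof induction
    case (scal_mult a b)
    show ?case using ext_eq.scal_mult[of b a] by (simp add: mult.commute)
  next
    case (wdg_zero s)
    show ?case by simp (meson ext_eq.intros)
  next
    case (wdg_one s)
    show ?case by simp (meson ext_eq.intros)
  next
    case (vec_scale a x)
    show ?case by simp (meson ext_eq.intros)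
  qed (auto intro: ext_eq.intros)
qed

lemma involute_vec_mv [simp]: "involute (vec_mv x) = - vec_mv x"
  using ext_eq.vec_scale[of "-1" x] by (transfer fixing: x) simp

lemma involute_simps [simp]:
  "involute 1 = 1" "involute (r *\<^sub>R M) = r *\<^sub>R involute M"
  "involute (M + N) = involute M + involute N" 
  "involute (M \<^bold>\<and> N) = involute M \<^bold>\<and> involute N"
  by (transfer, simp add: ext_eq.refl)+

lemma reverse_scaleR [simp]: "reverse (r *\<^sub>R M) = r *\<^sub>R reverse M"
  by transfer (simp, rule ext_eq.sym[OF ext_eq.scal_central])

lemma reverse_simps [simp]:
  "reverse 1 = 1" "reverse (vec_mv x) = vec_mv x" 
  "reverse (M + N) = reverse M + reverse N" 
  "reverse (M \<^bold>\<and> N) = reverse N \<^bold>\<and> reverse M"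
  by (transfer, simp add: ext_eq.refl)+

lemma linear_involute: "linear involute"
  by (rule linearI) simp_all

lemma linear_reverse: "linear reverse"
  by (rule linearI) simp_all

lemmas involute_linear_simps [simp] =
  linear_0[OF linear_involute] linear_neg[OF linear_involute]

lemma involute_involute [simp]: "involute (involute M) = M"
  by (induction M rule: multivector_induct) (simp_all add: linear_neg[OF linear_involute])

text \<open>
  Moving \<open>v\<close> across a factor from \<open>X\<close> costs one sign, and \<open>involute\<close> collects these signs.
\<close>

lemma vec_mv_wedge_commute: "vec_mv v \<^bold>\<and> M = involute M \<^bold>\<and> vec_mv v"
proof (induction M rule: multivector_induct)
  case (vector x)
  show ?case using vec_mv_anticommute[of v x] by (simp add: wedge_simps)
next
  case (wedge M N)
  then show ?case by (simp add: wedge_assoc flip: wedge_assoc[of "vec_mv v"])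
qed (simp_all add: wedge_simps)

lemma involute_wedge_list: "involute (wedge_list vs) = (- 1) ^ length vs *\<^sub>R wedge_list vs"
  by (induction vs) (simp_all add: wedge_simps)

lemma reverse_wedge_list: "reverse (wedge_list vs) = wedge_list (rev vs)"
  by (induction vs) (simp_all add: wedge_list_append wedge_simps)

lemma wedge_list_rev:
  "wedge_list (rev vs) = (- 1) ^ (length vs * (length vs - 1) div 2) *\<^sub>R wedge_list vs"
proof (induction vs)
  case (Cons v vs)
  let ?n = "length vs"
  have "wedge_list (rev (v # vs)) = (- 1) ^ (?n * (?n - 1) div 2) *\<^sub>R (wedge_list vs \<^bold>\<and> vec_mv v)"
    by (simp add: wedge_list_append Cons wedge_simps)
  also have "wedge_list vs \<^bold>\<and> vec_mv v = (- 1) ^ ?n *\<^sub>R (vec_mv v \<^bold>\<and> wedge_list vs)"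
    by (simp add: vec_mv_wedge_commute involute_wedge_list wedge_simps flip: power_mult_distrib)
  also have "?n * (?n - 1) div 2 + ?n = Suc ?n * (Suc ?n - 1) div 2"
    by (cases ?n) (auto simp: algebra_simps)
  then have "(- 1) ^ (?n * (?n - 1) div 2) *\<^sub>R (- 1) ^ ?n *\<^sub>R (vec_mv v \<^bold>\<and> wedge_list vs)
      = (- 1) ^ (Suc ?n * (Suc ?n - 1) div 2) *\<^sub>R (vec_mv v \<^bold>\<and> wedge_list vs)"
    by (simp flip: power_add)
  finally show ?case by simp
qed simp

text \<open>
  Wedge products of vectors span, so a linear map is determined by how it scales each grade.
\<close>

lemma THE_linear_scaling_grades:
  fixes h :: "'a::real_vector multivector \<Rightarrow> 'a multivector"
  assumes "linear h" "\<And>vs. h (wedge_list vs) = c (length vs) *\<^sub>R wedge_list vs"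
  shows "(THE f. linear f \<and> (\<forall>k. \<forall>M\<in>grade k. f M = c k *\<^sub>R M)) = h"
proof (rule the_equality)
  have "h M = c k *\<^sub>R M" if "M \<in> grade k" for M k
    using that unfolding grade_def
  proof (induction rule: span_induct_alt)
    case (step a L y)
    then show ?case
      by (auto simp: linear_add[OF assms(1)] linear_scale[OF assms(1)] assms(2) algebra_simps)
  qed (simp add: linear_0[OF assms(1)])
  with assms(1) show "linear h \<and> (\<forall>k. \<forall>M\<in>grade k. h M = c k *\<^sub>R M)" by blast
  fix f :: "'a multivector \<Rightarrow> 'a multivector"
  assume f: "linear f \<and> (\<forall>k. \<forall>M\<in>grade k. f M = c k *\<^sub>R M)"
  then show "f = h"
    by (intro linear_eq_on_wedge_lists) (auto simp: assms wedge_list_in_grade)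
qed

lemma grade_involution_eq: "grade_involution = involute"
  unfolding grade_involution_def
  by (rule THE_linear_scaling_grades[OF linear_involute involute_wedge_list])

lemma reversion_eq: "reversion = reverse"
  unfolding reversion_def
  by (rule THE_linear_scaling_grades[OF linear_reverse])
     (simp only: reverse_wedge_list wedge_list_rev)

section \<open>Interior products and contractions\<close>

text \<open>
  \<open>interior u\<close> is the antiderivation extending the functional \<open>inner u\<close> on \<open>X\<close>. A recursion on
  expressions defines it at once on the whole algebra; what has to be checked is that it respects the
  defining relations, the essential one being
  \<open>interior u (x \<and> x) = inner u x *\<^sub>R x - inner u x *\<^sub>R x = 0\<close>.
\<close>

primrec interior_term :: "'a::real_inner \<Rightarrow> 'a ext_term \<Rightarrow> 'a multivector" where
  "interior_term u (Scal r) = 0"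
| "interior_term u (Vec x) = inner u x *\<^sub>R 1"
| "interior_term u (Add s t) = interior_term u s + interior_term u t"
| "interior_term u (Wdg s t) =
     interior_term u s \<^bold>\<and> abs_multivector t + involute (abs_multivector s) \<^bold>\<and> interior_term u t"

lift_definition interior :: "'a::real_inner \<Rightarrow> 'a multivector \<Rightarrow> 'a multivector"
  is interior_term
proof -
  fix u :: 'a and s t :: "'a ext_term"
  assume "ext_eq s t"
  then show "interior_term u s = interior_term u t"
  proof induction
    case (wdg_cong s s' t t')
    then have "abs_multivector s = abs_multivector s'" "abs_multivector t = abs_multivector t'"
      by (simp_all add: multivector.abs_eq_iff)
    with wdg_cong show ?case by simp
  qed (simp_all add: abs_multivector_simps wedge_simps wedge_assoc algebra_simps inner_add_right)
qed

lemma interior_scaleR [simp]: "interior u (r *\<^sub>R M) = r *\<^sub>R interior u M"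
  by transfer (simp add: abs_multivector_simps wedge_simps)

lemma interior_one [simp]: "interior u 1 = 0"
  by transfer simp

lemma interior_vec_mv [simp]: "interior u (vec_mv x) = inner u x *\<^sub>R 1"
  by transfer simp

lemma interior_add [simp]: "interior u (M + N) = interior u M + interior u N"
  by transfer simp

lemma interior_wedge:
  "interior u (M \<^bold>\<and> N) = interior u M \<^bold>\<and> N + involute M \<^bold>\<and> interior u N"
  by (induct M, induct N)
     (simp add: abs_multivector_simps interior.abs_eq flip: abs_multivector_simps(4))

lemma linear_interior: "linear (interior u)"
  by (rule linearI) simp_all

lemmas interior_linear_simps [simp] =
  linear_0[OF linear_interior] linear_neg[OF linear_interior] linear_diff[OF linear_interior]

lemma interior_involute [simp]: "interior u (involute M) = - involute (interior u M)"
  by (induction M rule: multivector_induct)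
     (simp_all add: interior_wedge wedge_simps)

lemma interior_vec_wedge:
  "interior u (vec_mv x \<^bold>\<and> M) = inner u x *\<^sub>R M - vec_mv x \<^bold>\<and> interior u M"
  by (simp add: interior_wedge wedge_simps)

lemma interior_anticommute: "interior u (interior w M) = - interior w (interior u M)"
  by (induction M rule: multivector_induct)
     (simp_all add: interior_wedge wedge_simps)

lemma interior_interior [simp]: "interior u (interior u M) = 0"
  using interior_anticommute[of u u M] by (simp add: eq_neg_iff_add_eq_0 flip: scaleR_2)

lemma interior_add_left: "interior (u + w) M = interior u M + interior w M"
  by (induction M rule: multivector_induct)
     (simp_all add: interior_wedge wedge_simps inner_add_left algebra_simps)

lemma interior_scaleR_left: "interior (r *\<^sub>R u) M = r *\<^sub>R interior u M"
  by (induction M rule: multivector_induct)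
     (simp_all add: interior_wedge wedge_simps algebra_simps)

lemma interior_wedge_list_orthogonal:
  assumes "\<And>w. w \<in> set ws \<Longrightarrow> inner u w = 0"
  shows "interior u (wedge_list ws) = 0"
  using assms by (induction ws) (simp_all add: interior_vec_wedge wedge_simps)

text \<open>
  The operators \<open>interior x\<close> square to zero and depend linearly on \<open>x\<close>, so \<open>x \<mapsto> interior x\<close> extends to an
  action of the exterior algebra on itself. The order of the two factors in the last equation makes
  it a right action, which is what the adjoint of \<open>L \<mapsto> M \<and> L\<close> requires.
\<close>

primrec contract_term :: "'a::real_inner ext_term \<Rightarrow> 'a multivector \<Rightarrow> 'a multivector" where
  "contract_term (Scal r) N = r *\<^sub>R N"
| "contract_term (Vec x) N = interior x N"
| "contract_term (Add s t) N = contract_term s N + contract_term t N"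
| "contract_term (Wdg s t) N = contract_term t (contract_term s N)"

lemma linear_contract_term: "linear (contract_term s)"
proof (induction s)
  case (Wdg s t)
  then show ?case using linear_compose[OF Wdg] by (simp add: o_def)
qed (auto simp: linear_iff algebra_simps)

lift_definition contract :: "'a::real_inner multivector \<Rightarrow> 'a multivector \<Rightarrow> 'a multivector"
  is contract_term
proof -
  fix s t :: "'a ext_term"
  assume "ext_eq s t"
  then have "contract_term s N = contract_term t N" for N
    by (induction arbitrary: N)
       (simp_all add: interior_add_left interior_scaleR_left algebra_simps
         linear_0[OF linear_contract_term] linear_add[OF linear_contract_term] linear_scale[OF linear_contract_term])
  then show "contract_term s = contract_term t" by blast
qed

lemma contract_scaleR [simp]: "contract (r *\<^sub>R M) N = r *\<^sub>R contract M N"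
  by transfer (simp add: linear_scale[OF linear_contract_term])

lemma contract_one [simp]: "contract 1 N = N"
  by transfer simp

lemma contract_vec_mv [simp]: "contract (vec_mv x) N = interior x N"
  by transfer simp

lemma contract_add [simp]: "contract (L + M) N = contract L N + contract M N"
  by transfer simp

lemma contract_wedge [simp]: "contract (L \<^bold>\<and> M) N = contract M (contract L N)"
  by transfer simp

lemma bilinear_contract: "bilinear contract"
proof -
  have "linear (contract M)" for M :: "'a multivector"
    by transfer (rule linear_contract_term)
  then show ?thesis by (auto simp: bilinear_def intro: linearI)
qed

lemmas contract_linear_simps [simp] =
  bilinear_radd[OF bilinear_contract] bilinear_rmul[OF bilinear_contract]
  bilinear_rneg[OF bilinear_contract] bilinear_rzero[OF bilinear_contract]
  
lemma involute_contract_wedge_list: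
  "involute (contract (wedge_list us) N) = (- 1) ^ length us *\<^sub>R contract (wedge_list us) (involute N)"
  by (induction us arbitrary: N) (simp_all)

lift_definition scalar_part :: "'a::real_vector multivector \<Rightarrow> real"
  is "ext_term_eval (\<lambda>_. 0)"
  by (rule ext_term_eval_cong) (auto simp: module_hom_zero linear_zero)

lemma scalar_part_simps [simp]:
  "scalar_part 1 = 1" "scalar_part (vec_mv x) = 0"
  "scalar_part (M + N) = scalar_part M + scalar_part N"
  "scalar_part (M \<^bold>\<and> N) = scalar_part M * scalar_part N"
  "scalar_part (r *\<^sub>R M) = r * scalar_part M"
  by (transfer, simp)+

section \<open>The inner product and the left contraction\<close>

text \<open>
  The Laplace expansion of the Gram determinant along its first row, before pairing.
\<close>

lemma interior_wedge_list:
  "interior u (wedge_list ws) =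
     (\<Sum>j<length ws. ((- 1) ^ j * inner u (ws ! j)) *\<^sub>R wedge_list (take j ws @ drop (Suc j) ws))"
proof (induction ws)
  case (Cons w ws)
  then show ?case
    by (simp add: interior_vec_wedge sum.lessThan_Suc_shift wedge_simps
        linear_sum[OF bilinear_wedge[unfolded bilinear_def, THEN conjunct1, rule_format]]
        flip: sum_negf del: sum.lessThan_Suc)
qed simp

text \<open>
  This form is bilinear by construction, and \<open>contract M\<close> is by construction adjoint to \<open>L \<mapsto> M \<and> L\<close>.
  So nothing is left to show but that it has the values which characterise the inner product.
\<close>

definition contraction_form :: "'a::real_inner multivector \<Rightarrow> 'a multivector \<Rightarrow> real"
  where "contraction_form M N = scalar_part (contract M N)"

lemma bilinear_contraction_form: "bilinear contraction_form"
  by (simp add: bilinear_def linear_iff contraction_form_def)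

lemma contraction_form_wedge: "contraction_form (M \<^bold>\<and> L) N = contraction_form L (contract M N)"
  by (simp add: contraction_form_def)

lemma contraction_form_expand:
  "contraction_form (wedge_list (u # us)) (wedge_list ws) =
     (\<Sum>j<length ws. (- 1) ^ j * inner u (ws ! j) *
        contraction_form (wedge_list us) (wedge_list (take j ws @ drop (Suc j) ws)))"
proof -
  note lin = bilinear_contraction_form[unfolded bilinear_def, THEN conjunct1, rule_format]
  show ?thesis
    by (simp add: contraction_form_wedge interior_wedge_list linear_sum[OF lin] linear_scale[OF lin])
qed

lemma contraction_form_wedge_lists:
  assumes "length us = length ws"
  shows "contraction_form (wedge_list us) (wedge_list ws) =
    det (mat (length us) (length us) (\<lambda>(i, j). inner (us ! i) (ws ! j)))"
  using assms
proof (induction us arbitrary: ws)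
  case Nil
  then show ?case by (simp add: contraction_form_def)
next
  case (Cons u us)
  let ?n = "length us"
  let ?A = "mat (Suc ?n) (Suc ?n) (\<lambda>(i, j). inner ((u # us) ! i) (ws ! j))"
  have minor: "mat_delete ?A 0 j =
      mat ?n ?n (\<lambda>(i, k). inner (us ! i) ((take j ws @ drop (Suc j) ws) ! k))" if "j < Suc ?n" for j
    using that Cons.prems by (auto simp: mat_delete_def nth_append intro!: eq_matI)
  have "det ?A = (\<Sum>j<Suc ?n. ?A $$ (0, j) * cofactor ?A 0 j)"
    by (rule laplace_expansion_row) auto
  also have "\<dots> = (\<Sum>j<Suc ?n. (- 1) ^ j * inner u (ws ! j) *
      contraction_form (wedge_list us) (wedge_list (take j ws @ drop (Suc j) ws)))"
  proof (rule sum.cong)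
    fix j assume j: "j \<in> {..<Suc ?n}"
    then have "cofactor ?A 0 j = (- 1) ^ j *
        contraction_form (wedge_list us) (wedge_list (take j ws @ drop (Suc j) ws))"
      using Cons.prems by (subst Cons.IH) (auto simp only: cofactor_def minor lessThan_iff, auto)
    with j show "?A $$ (0, j) * cofactor ?A 0 j = (- 1) ^ j * inner u (ws ! j) *
        contraction_form (wedge_list us) (wedge_list (take j ws @ drop (Suc j) ws))" by simp
  qed simp
  also have "\<dots> = contraction_form (wedge_list (u # us)) (wedge_list ws)"
    using Cons.prems by (simp only: contraction_form_expand) simp
  finally show ?case by simp
qed

lemma contraction_form_length_neq:
  assumes "length us \<noteq> length ws"
  shows "contraction_form (wedge_list us) (wedge_list ws) = 0"
  using assms
proof (induction us arbitrary: ws)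
  case Nil
  then show ?case by (cases ws) (simp_all add: contraction_form_def)
next
  case (Cons u us)
  then show ?case
    by (auto simp only: contraction_form_expand intro!: sum.neutral) auto
qed

lemma mv_inner_eq: "mv_inner = (contraction_form :: 'a::real_inner multivector \<Rightarrow> _)"
  unfolding mv_inner_def
proof (rule the_equality, intro conjI allI impI ballI)
  fix j k :: nat and M N :: "'a multivector"
  assume "j \<noteq> k" and M: "M \<in> grade j" and N: "N \<in> grade k"
  have zero: "bilinear (\<lambda>(_::'a multivector) (_::'a multivector). 0::real)"
    by (simp add: bilinear_def linear_iff)
  show "contraction_form M N = 0"
    by (rule bilinear_eq[OF bilinear_contraction_form zero _ _ M N])
       (use \<open>j \<noteq> k\<close> in \<open>auto simp: grade_def contraction_form_length_neq\<close>)
next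
  fix B :: "'a multivector \<Rightarrow> 'a multivector \<Rightarrow> real"
  assume B: "bilinear B
     \<and> (\<forall>a b. B (a *\<^sub>R 1) (b *\<^sub>R 1) = a * b)
     \<and> (\<forall>p vs ws. length vs = p \<longrightarrow> length ws = p \<longrightarrow>
          B (wedge_list vs) (wedge_list ws) = det (mat p p (\<lambda>(i, j). inner (vs ! i) (ws ! j))))
     \<and> (\<forall>j k. j \<noteq> k \<longrightarrow> (\<forall>M\<in>grade j. \<forall>N\<in>grade k. B M N = 0))"
  have "B M N = contraction_form M N" for M N
  proof (rule bilinear_eq[OF conjunct1[OF B] bilinear_contraction_form, where x = M and y = N])
    show "M \<in> UNIV" "N \<in> UNIV" by simp_all
    fix L K assume "L \<in> range (wedge_list :: 'a list \<Rightarrow> _)" "K \<in> range (wedge_list :: 'a list \<Rightarrow> _)"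
    then obtain us ws where LK: "L = wedge_list us" "K = wedge_list ws" by blast
    show "B L K = contraction_form L K"
    proof (cases "length us = length ws")
      case True
      with B show ?thesis by (simp add: LK contraction_form_wedge_lists)
    next
      case False
      with B show ?thesis
        unfolding LK by (metis contraction_form_length_neq wedge_list_in_grade)
    qed
  qed (simp_all add: span_wedge_lists)
  then show "B = contraction_form" by blast
qed (auto simp: bilinear_contraction_form contraction_form_wedge_lists, simp add: contraction_form_def)

definition orthonormal :: "'a::real_inner list \<Rightarrow> bool" where
  "orthonormal es \<longleftrightarrow> distinct es \<and>
     (\<forall>e\<in>set es. \<forall>f\<in>set es. inner e f = (if e = f then 1 else 0))"

lemma orthonormal_spanning_list_exists:
  assumes "finite B" "span B = (UNIV :: 'a::real_inner set)"
  obtains es where "orthonormal es" "span (set es) = (UNIV :: 'a set)"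
proof -
  obtain C where C: "finite C" "span C = (UNIV :: 'a set)" "pairwise Linear_Algebra.orthogonal C"
    using basis_orthogonal[OF assms(1)] assms(2) by metis
  define D where "D = (\<lambda>x. x /\<^sub>R norm x) ` (C - {0})"
  obtain es where es: "set es = D" "distinct es"
    using finite_distinct_list[of D] C(1) by (auto simp: D_def)
  have "inner e f = (if e = f then 1 else 0)" if ef: "e \<in> D" "f \<in> D" for e f
  proof -
    obtain x y where xy: "x \<in> C - {0}" "e = x /\<^sub>R norm x" "y \<in> C - {0}" "f = y /\<^sub>R norm y"
      using ef unfolding D_def by blast
    show ?thesis
    proof (cases "x = y")
      case True
      with xy have "inner e f = 1" by (simp add: power2_norm_eq_inner[symmetric] power2_eq_square)
      with True xy show ?thesis by simp
    next
      case False
      with xy C(3) have "inner e f = 0" by (auto simp: pairwise_def Linear_Algebra.orthogonal_def)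
      moreover have "inner e e \<noteq> 0" using xy by simp
      ultimately show ?thesis by auto
    qed
  qed
  with es have "orthonormal es" by (simp add: orthonormal_def)
  moreover have "C - {0} \<subseteq> span D"
  proof
    fix x assume x: "x \<in> C - {0}"
    then have "norm x *\<^sub>R (x /\<^sub>R norm x) \<in> span D"
      by (intro span_scale span_base) (auto simp: D_def)
    with x show "x \<in> span D" by simp
  qed
  then have "span (C - {0}) \<subseteq> span D" by (rule span_minimal) (rule subspace_span)
  then have "span D = UNIV" using C(2) span_delete_0[of C] by auto
  ultimately show thesis using that es by blast
qed

text \<open>
  The subalgebra generated by a list of vectors, in a form that splits off one generator at a time:
  every element is \<open>K + e \<and> L\<close> with \<open>K\<close>, \<open>L\<close> free of \<open>e\<close>.
\<close>

primrec multivectors_over :: "'a::real_vector list \<Rightarrow> 'a multivector set" where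
  "multivectors_over [] = range (\<lambda>r. r *\<^sub>R 1)"
| "multivectors_over (e # es) =
     {K + vec_mv e \<^bold>\<and> L | K L. K \<in> multivectors_over es \<and> L \<in> multivectors_over es}"

lemma subspace_multivectors_over: "subspace (multivectors_over es)"
proof (induction es)
  case Nil
  have "subspace ((\<lambda>r. r *\<^sub>R (1 :: 'a multivector)) ` UNIV)"
    by (rule linear_subspace_image) (auto intro: linearI simp: algebra_simps)
  then show ?case by simp
next
  case (Cons e es)
  show ?case
  proof (rule subspaceI)
    show "0 \<in> multivectors_over (e # es)"
      using subspace_0[OF Cons] by (force simp: wedge_simps)
  next
    fix x y assume "x \<in> multivectors_over (e # es)" "y \<in> multivectors_over (e # es)"
    then obtain K L K' L' where "x = K + vec_mv e \<^bold>\<and> L" "y = K' + vec_mv e \<^bold>\<and> L'"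
      and "{K, L, K', L'} \<subseteq> multivectors_over es" by auto
    then have "x + y = (K + K') + vec_mv e \<^bold>\<and> (L + L')"
      "K + K' \<in> multivectors_over es" "L + L' \<in> multivectors_over es"
      by (auto simp: wedge_simps subspace_add[OF Cons])
    then show "x + y \<in> multivectors_over (e # es)" by auto
  next
    fix c x assume "x \<in> multivectors_over (e # es)"
    then obtain K L where "x = K + vec_mv e \<^bold>\<and> L" "K \<in> multivectors_over es" "L \<in> multivectors_over es"
      by auto
    then have "c *\<^sub>R x = c *\<^sub>R K + vec_mv e \<^bold>\<and> (c *\<^sub>R L)"
      "c *\<^sub>R K \<in> multivectors_over es" "c *\<^sub>R L \<in> multivectors_over es"
      by (auto simp: wedge_simps algebra_simps subspace_scale[OF Cons])
    then show "c *\<^sub>R x \<in> multivectors_over (e # es)" by auto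
  qed
qed

lemma multivectors_over_mono: "multivectors_over es \<subseteq> multivectors_over (e # es)"
  using subspace_0[OF subspace_multivectors_over[of es]] by (force simp: wedge_simps)

lemma vec_wedge_multivectors_over:
  assumes "f \<in> set es" "M \<in> multivectors_over es"
  shows "vec_mv f \<^bold>\<and> M \<in> multivectors_over es"
  using assms
proof (induction es arbitrary: M)
  case (Cons e es)
  then obtain K L where M: "M = K + vec_mv e \<^bold>\<and> L"
    and KL: "K \<in> multivectors_over es" "L \<in> multivectors_over es"
    by auto
  note sub = subspace_multivectors_over[of es]
  show ?case
  proof (cases "f = e")
    case True
    then have "vec_mv f \<^bold>\<and> M = 0 + vec_mv e \<^bold>\<and> K"
      by (simp add: M wedge_simps vec_wedge_vec_wedge_self)
    with KL subspace_0[OF sub] show ?thesis unfolding multivectors_over.simps by blast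
  next
    case False
    then have "vec_mv f \<^bold>\<and> M = vec_mv f \<^bold>\<and> K + vec_mv e \<^bold>\<and> (- (vec_mv f \<^bold>\<and> L))"
      by (simp add: M wedge_simps vec_wedge_left_commute[of f e])
    moreover have "vec_mv f \<^bold>\<and> K \<in> multivectors_over es" "- (vec_mv f \<^bold>\<and> L) \<in> multivectors_over es"
      using False Cons KL by (auto intro: subspace_neg[OF sub])
    ultimately show ?thesis by auto
  qed
qed simp

lemma multivectors_over_spanning_list:
  assumes "span (set es) = UNIV"
  shows "multivectors_over es = UNIV"
proof (rule subspace_closed_under_vectors_is_UNIV[OF subspace_multivectors_over _ _ assms])
  show "1 \<in> multivectors_over es"
  proof (induction es)
    case Nil
    show ?case by simp (metis rangeI scaleR_one)
  qed (use multivectors_over_mono in blast)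
qed (rule vec_wedge_multivectors_over)

lemma interior_multivectors_over_orthogonal:
  assumes "M \<in> multivectors_over es" "\<And>e. e \<in> set es \<Longrightarrow> inner u e = 0"
  shows "interior u M = 0"
  using assms
  by (induction es arbitrary: M) (auto simp: interior_vec_wedge wedge_simps)

text \<open>
  For \<open>K = K\<^sub>0 + e \<and> K\<^sub>1\<close> with \<open>e\<close> a unit vector orthogonal to the remaining generators,
  \<open>interior e K = K\<^sub>1\<close>. As \<open>interior e\<close> is adjoint to \<open>e \<and> _\<close>, an element \<open>K\<close> orthogonal to everything
  passes this property on to \<open>K\<^sub>1\<close> and then to \<open>K\<^sub>0\<close>, and the induction ends at the scalars.
\<close>

lemma contraction_form_nondegenerate_over:
  assumes "orthonormal es" "K \<in> multivectors_over es" "\<And>L. contraction_form L K = 0"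
  shows "K = 0"
  using assms
proof (induction es arbitrary: K)
  case Nil
  then obtain r where "K = r *\<^sub>R 1" by auto
  with Nil(3)[of 1] show ?case by (simp add: contraction_form_def)
next
  case (Cons e es)
  then obtain K\<^sub>0 K\<^sub>1 where K: "K = K\<^sub>0 + vec_mv e \<^bold>\<and> K\<^sub>1"
    and mem: "K\<^sub>0 \<in> multivectors_over es" "K\<^sub>1 \<in> multivectors_over es" by auto
  have es: "orthonormal es" and e: "inner e e = 1" "\<And>f. f \<in> set es \<Longrightarrow> inner e f = 0"
    using Cons.prems(1) by (auto simp: orthonormal_def)
  have "interior e K = K\<^sub>1"
    using mem e by (simp add: K interior_vec_wedge interior_multivectors_over_orthogonal wedge_simps)
  then have "contraction_form L K\<^sub>1 = 0" for L
    using Cons.prems(3)[of "vec_mv e \<^bold>\<and> L"] by (simp add: contraction_form_wedge)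
  then have "K\<^sub>1 = 0" using Cons.IH es mem by blast
  then have "K = K\<^sub>0" by (simp add: K wedge_simps)
  then show ?case using Cons.IH es mem Cons.prems(3) by blast
qed

lemma left_contraction_eq:
  assumes "orthonormal es" "span (set es) = (UNIV :: 'a::real_inner set)"
  shows "M \<^bold>\<rfloor> N = contract M (N :: 'a multivector)"
  unfolding left_contraction_def mv_inner_eq contraction_form_wedge
proof (rule the_equality)
  fix K assume "\<forall>L. contraction_form L K = contraction_form L (contract M N)"
  then have "contraction_form L (K - contract M N) = 0" for L
    by (simp add: bilinear_rsub[OF bilinear_contraction_form])
  then show "K = contract M N"
    using contraction_form_nondegenerate_over assms multivectors_over_spanning_list
    by (metis UNIV_I eq_iff_diff_eq_0)
qed simp

section \<open>Deforming the exterior product into the geometric product\<close>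

text \<open>
  The properties shared by the exterior product and the geometric product. The law \<open>interior_prod\<close>
  is the case of one vector of the first expansion.
\<close>

locale graded_product =
  fixes prod :: "'a::real_inner multivector \<Rightarrow> 'a multivector \<Rightarrow> 'a multivector" (infixl \<open>\<star>\<close> 76)
  assumes bilinear_prod: "bilinear (\<star>)"
    and prod_assoc: "(L \<star> M) \<star> N = L \<star> (M \<star> N)"
    and prod_one [simp]: "1 \<star> M = M" "M \<star> 1 = M"
    and involute_prod [simp]: "involute (M \<star> N) = involute M \<star> involute N"
    and interior_prod: "interior u (M \<star> N) = interior u M \<star> N + involute M \<star> interior u N"
begin

lemmas prod_simps =
  bilinear_ladd[OF bilinear_prod] bilinear_radd[OF bilinear_prod]
  bilinear_lmul[OF bilinear_prod] bilinear_rmul[OF bilinear_prod]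
  bilinear_lneg[OF bilinear_prod] bilinear_rneg[OF bilinear_prod]
  bilinear_lzero[OF bilinear_prod] bilinear_rzero[OF bilinear_prod]

end

lemma graded_product_wedge: "graded_product (\<^bold>\<and>)"
  by unfold_locales (simp_all add: bilinear_wedge wedge_assoc wedge_one interior_wedge)

text \<open>
  Here \<open>involute (interior e M)\<close> is the right contraction of \<open>M\<close> by \<open>e\<close>. With \<open>T\<close> the operator on
  \<open>\<And>X \<otimes> \<And>X\<close> that contracts the left factor from the right and the right factor from the left by \<open>e\<close>,
  \<open>deform e g\<close> is \<open>g\<close> composed with \<open>exp T = 1 + T\<close>, because \<open>T\<^sup>2 = 0\<close>.
\<close>

definition deform :: "'a::real_inner \<Rightarrow> ('a multivector \<Rightarrow> 'a multivector \<Rightarrow> 'a multivector)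
    \<Rightarrow> 'a multivector \<Rightarrow> 'a multivector \<Rightarrow> 'a multivector"
  where "deform e g M N = g M N + g (involute (interior e M)) (interior e N)"

context graded_product
begin

text \<open>
  A direct computation from the antiderivation law. Both bracketings of a triple product
  \<open>L, M, N\<close> expand to the same four terms, in which \<open>e\<close> is contracted between no two factors, between
  \<open>L\<close> and \<open>M\<close>, between \<open>M\<close> and \<open>N\<close>, or between \<open>L\<close> and \<open>N\<close>; two contractions by \<open>e\<close> of the same
  factor vanish. For \<open>interior u\<close> one uses that it anticommutes with \<open>interior e\<close>.
\<close>

lemma graded_product_deform: "graded_product (deform e (\<star>))"
proof
  show "bilinear (deform e (\<star>))"
    by (auto simp: bilinear_def deform_def prod_simps algebra_simps intro!: linearI)
  show "deform e (\<star>) (deform e (\<star>) L M) N = deform e (\<star>) L (deform e (\<star>) M N)" for L M N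
    by (simp add: deform_def prod_simps prod_assoc interior_prod)
  show "deform e (\<star>) 1 M = M" "deform e (\<star>) M 1 = M" for M
    by (simp_all add: deform_def prod_simps)
  show "involute (deform e (\<star>) M N) = deform e (\<star>) (involute M) (involute N)" for M N
    by (simp add: deform_def prod_simps)
  show "interior u (deform e (\<star>) M N)
      = deform e (\<star>) (interior u M) N + deform e (\<star>) (involute M) (interior u N)" for u M N
    by (simp add: deform_def prod_simps interior_prod interior_anticommute[of u e])
qed

text \<open>
  The vector \<open>w\<close> is the part of \<open>v\<close> that the deformations made so far take into account. Once the
  directions exhaust an orthonormal basis, \<open>w = v\<close>.
\<close>

lemma deform_vec_mv:
  assumes "\<And>M. vec_mv v \<star> M = vec_mv v \<^bold>\<and> M + interior w M"
  shows "deform e (\<star>) (vec_mv v) M = vec_mv v \<^bold>\<and> M + interior (inner e v *\<^sub>R e + w) M"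
  by (simp add: deform_def assms prod_simps interior_add_left interior_scaleR_left)

text \<open>
  This invariant becomes, for \<open>w = v\<close>, the case of one vector of the second expansion. It starts
  from \<open>v \<and> (M \<and> N) = involute M \<and> (v \<and> N)\<close>; the correction term arises from the failure of
  \<open>interior e\<close> and \<open>v \<and> _\<close> to anticommute, which is the scalar \<open>inner e v\<close>.
\<close>

lemma vec_mv_wedge_deform:
  assumes "\<And>M N. vec_mv v \<^bold>\<and> (M \<star> N) = involute M \<star> (vec_mv v \<^bold>\<and> N) + interior w M \<star> N"
  shows "vec_mv v \<^bold>\<and> deform e (\<star>) M N =
    deform e (\<star>) (involute M) (vec_mv v \<^bold>\<and> N) + deform e (\<star>) (interior (inner e v *\<^sub>R e + w) M) N"
  by (simp add: deform_def wedge_simps assms prod_simps interior_vec_wedge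
      interior_add_left interior_scaleR_left interior_anticommute[of w e]
      bilinear_rsub[OF bilinear_prod] algebra_simps)

end

text \<open>
  The geometric product relative to a list of directions; for an orthonormal basis it is the
  geometric product of \<open>X\<close>.
\<close>

definition clifford :: "'a::real_inner list \<Rightarrow> 'a multivector \<Rightarrow> 'a multivector \<Rightarrow> 'a multivector"
  where "clifford es = foldr deform es (\<^bold>\<and>)"

lemma clifford_simps:
  "clifford [] = (\<^bold>\<and>)" "clifford (e # es) = deform e (clifford es)"
  by (simp_all add: clifford_def)

lemma graded_product_clifford: "graded_product (clifford es)"
  by (induction es)
     (simp_all add: clifford_simps graded_product_wedge graded_product.graded_product_deform)

lemma clifford_vec_mv:
  "clifford es (vec_mv v) M = vec_mv v \<^bold>\<and> M + interior (\<Sum>e\<leftarrow>es. inner e v *\<^sub>R e) M"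
proof (induction es arbitrary: M)
  case Nil
  show ?case using interior_scaleR_left[of 0 0 M] by (simp add: clifford_simps)
next
  case (Cons e es)
  show ?case
    using graded_product.deform_vec_mv[OF graded_product_clifford Cons] by (simp add: clifford_simps)
qed

lemma vec_mv_wedge_clifford:
  "vec_mv v \<^bold>\<and> clifford es M N =
     clifford es (involute M) (vec_mv v \<^bold>\<and> N) + clifford es (interior (\<Sum>e\<leftarrow>es. inner e v *\<^sub>R e) M) N"
proof (induction es arbitrary: M N)
  case Nil
  have "vec_mv v \<^bold>\<and> (M \<^bold>\<and> N) = (involute M \<^bold>\<and> vec_mv v) \<^bold>\<and> N"
    by (simp flip: vec_mv_wedge_commute wedge_assoc)
  then show ?case
    using interior_scaleR_left[of 0 0 M] by (simp add: clifford_simps wedge_assoc wedge_simps)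
next
  case (Cons e es)
  show ?case
    using graded_product.vec_mv_wedge_deform[OF graded_product_clifford Cons]
    by (simp add: clifford_simps)
qed

lemma orthonormal_expansion:
  assumes "orthonormal es" "v \<in> span (set es)"
  shows "(\<Sum>e\<leftarrow>es. inner e v *\<^sub>R e) = v"
proof -
  have "(\<Sum>e\<in>set es. inner e v *\<^sub>R e) = v"
    using assms(2)
  proof (induction rule: span_induct_alt)
    case (step c f y)
    have "(\<Sum>e\<in>set es. inner e f *\<^sub>R e) = (\<Sum>e\<in>set es. if e = f then e else 0)"
      using assms(1) step(1) by (intro sum.cong) (auto simp: orthonormal_def)
    also have "\<dots> = f" using step(1) by simp
    finally have "c *\<^sub>R (\<Sum>e\<in>set es. inner e f *\<^sub>R e) = c *\<^sub>R f" by simp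
    with step show ?case
      by (simp add: inner_add_right scaleR_add_left sum.distrib scaleR_sum_right)
  qed simp
  with assms(1) show ?thesis
    by (simp add: orthonormal_def sum_list_distinct_conv_sum_set)
qed

text \<open>
  Left multiplication by \<open>v\<close> is \<open>v \<and> _\<close> plus \<open>interior v\<close>. This gives \<open>v v = \<parallel>v\<parallel>\<^sup>2\<close>, and on a product of
  vectors orthogonal to \<open>v\<close> the second summand vanishes.
\<close>

lemma is_geometric_product_clifford:
  assumes "orthonormal es" "span (set es) = UNIV"
  shows "is_geometric_product (clifford es)"
proof -
  interpret graded_product "clifford es" by (rule graded_product_clifford)
  have vec: "clifford es (vec_mv v) M = vec_mv v \<^bold>\<and> M + interior v M" for v M
    by (simp add: clifford_vec_mv orthonormal_expansion assms)
  have "foldr (\<lambda>v. clifford es (vec_mv v)) vs 1 = wedge_list vs"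
    if "\<forall>i<length vs. \<forall>j<length vs. i \<noteq> j \<longrightarrow> inner (vs ! i) (vs ! j) = 0" for vs
    using that
  proof (induction vs)
    case (Cons v vs)
    have "inner v w = 0" if w: "w \<in> set vs" for w
    proof -
      obtain i where "i < length vs" "w = vs ! i" using w by (auto simp: in_set_conv_nth)
      then show ?thesis using Cons.prems[rule_format, of 0 "Suc i"] by simp
    qed
    then have "interior v (wedge_list vs) = 0" by (rule interior_wedge_list_orthogonal)
    moreover have "foldr (\<lambda>v. clifford es (vec_mv v)) vs 1 = wedge_list vs"
    proof (rule Cons.IH, intro allI impI)
      fix i j assume "i < length vs" "j < length vs" "i \<noteq> j"
      then show "inner (vs ! i) (vs ! j) = 0" using Cons.prems[rule_format, of "Suc i" "Suc j"] by simp
    qed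
    ultimately show ?case using vec[of v "wedge_list vs"] by simp
  qed simp
  then show ?thesis
    by (simp add: is_geometric_product_def bilinear_prod prod_assoc vec vec_mv_wedge_self
        power2_norm_eq_inner)
qed

section \<open>Uniqueness of the geometric product\<close>

lemma span_distinct_wedge_lists:
  assumes "span B = UNIV"
  shows "span {wedge_list fs | fs. distinct fs \<and> set fs \<subseteq> B} = UNIV" (is "span ?G = _")
proof (rule span_closed_under_vectors_is_UNIV[OF _ _ assms])
  show "1 \<in> span ?G" by (rule span_base) (auto intro: exI[of _ "[]"])
  fix e M assume "e \<in> B" "M \<in> ?G"
  then obtain fs where fs: "M = wedge_list fs" "distinct fs" "set fs \<subseteq> B" by blast
  show "vec_mv e \<^bold>\<and> M \<in> span ?G"
  proof (cases "e \<in> set fs")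
    case False
    with fs \<open>e \<in> B\<close> have "vec_mv e \<^bold>\<and> M \<in> ?G" by (auto intro!: exI[of _ "e # fs"])
    then show ?thesis by (rule span_base)
  qed (simp add: fs vec_wedge_wedge_list_member span_zero)
qed

text \<open>
  The spanning set is arranged so that multiplication by the basis vector \<open>e\<close> is visibly determined on
  each of its elements: either \<open>e\<close> is a new factor, or it cancels against the first one. Reordering
  factors is thereby avoided.
\<close>

lemma span_wedge_lists_avoiding:
  assumes "span B = UNIV"
  shows "span ({wedge_list fs | fs. distinct fs \<and> set fs \<subseteq> B - {e}} \<union>
    {wedge_list (e # fs) | fs. distinct fs \<and> set fs \<subseteq> B - {e}}) = UNIV" (is "span (?G \<union> ?H) = _")
proof (rule span_closed_under_vectors_is_UNIV[OF _ _ assms])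
  show "1 \<in> span (?G \<union> ?H)" by (rule span_base) (auto intro: exI[of _ "[]"])
  fix f M assume "f \<in> B" "M \<in> ?G \<union> ?H"
  then obtain fs where M: "M = wedge_list fs \<or> M = wedge_list (e # fs)"
    and fs: "distinct fs" "set fs \<subseteq> B - {e}" by blast
  show "vec_mv f \<^bold>\<and> M \<in> span (?G \<union> ?H)"
  proof (cases "f = e")
    case True
    from fs have "wedge_list (e # fs) \<in> span (?G \<union> ?H)" by (intro span_base) blast
    with M True show ?thesis by (auto simp: vec_wedge_vec_wedge_self span_zero)
  next
    case False
    note [simp] = vec_wedge_left_commute[of f e]
    show ?thesis
    proof (cases "f \<in> set fs")
      case True
      with M show ?thesis by (auto simp: vec_wedge_wedge_list_member wedge_simps span_zero)
    next
      case notin: False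
      with fs \<open>f \<in> B\<close> False have "distinct (f # fs)" "set (f # fs) \<subseteq> B - {e}" by auto
      then have "wedge_list (f # fs) \<in> span (?G \<union> ?H)" "wedge_list (e # f # fs) \<in> span (?G \<union> ?H)"
        by (blast intro: span_base)+
      with M show ?thesis by (auto intro: span_neg)
    qed
  qed
qed

text \<open>
  On products of distinct orthonormal vectors the axioms prescribe multiplication by a basis vector,
  since such products are also exterior products. This determines left multiplication by each basis
  vector, hence by associativity left multiplication by products of them, hence the product.
\<close>

lemma geometric_product_unique:
  fixes g h :: "'a::real_inner multivector \<Rightarrow> 'a multivector \<Rightarrow> 'a multivector"
  assumes "orthonormal es" "span (set es) = (UNIV :: 'a set)"
    and "is_geometric_product g" "is_geometric_product h"
  shows "g = h"
proof -
  have wl: "foldr (\<lambda>v. g (vec_mv v)) fs 1 = wedge_list fs"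
    if g: "is_geometric_product g" and fs: "distinct fs" "set fs \<subseteq> set es" for g fs
  proof -
    have "inner (fs ! i) (fs ! j) = 0" if "i < length fs" "j < length fs" "i \<noteq> j" for i j
    proof -
      have "fs ! i \<in> set es" "fs ! j \<in> set es" using that fs by auto
      moreover have "fs ! i \<noteq> fs ! j" using that fs by (simp add: nth_eq_iff_index_eq)
      ultimately show ?thesis using assms(1) by (simp add: orthonormal_def)
    qed
    with g show ?thesis by (simp add: is_geometric_product_def)
  qed
  have step: "g (vec_mv e) (wedge_list fs) = wedge_list (e # fs)"
    if "is_geometric_product g" "distinct (e # fs)" "set (e # fs) \<subseteq> set es" for g e fs
    using wl[OF that(1), of fs] wl[OF that] that by simp
  have square: "g (vec_mv e) (wedge_list (e # fs)) = (norm e)\<^sup>2 *\<^sub>R wedge_list fs"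
    if g: "is_geometric_product g" and e: "distinct (e # fs)" "set (e # fs) \<subseteq> set es" for g e fs
  proof -
    have "g (g (vec_mv e) (vec_mv e)) (wedge_list fs) = g (vec_mv e) (g (vec_mv e) (wedge_list fs))"
      using g unfolding is_geometric_product_def by blast
    then have "g (vec_mv e) (wedge_list (e # fs)) = g (g (vec_mv e) (vec_mv e)) (wedge_list fs)"
      by (simp only: step[OF g e])
    also have "\<dots> = (norm e)\<^sup>2 *\<^sub>R wedge_list fs"
      using g bilinear_lmul[of g] by (simp add: is_geometric_product_def)
    finally show ?thesis .
  qed
  have lin: "linear (g L)" "linear (\<lambda>L. g L M)" if "is_geometric_product g"
    for g :: "'a multivector \<Rightarrow> 'a multivector \<Rightarrow> 'a multivector" and L M
    using that by (auto simp: is_geometric_product_def bilinear_def)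
  have vec: "g (vec_mv e) M = h (vec_mv e) M" if "e \<in> set es" for e M
  proof (rule linear_eq_on[OF lin(1)[OF assms(3)] lin(1)[OF assms(4)], of M])
    show "M \<in> span ({wedge_list fs | fs. distinct fs \<and> set fs \<subseteq> set es - {e}} \<union>
        {wedge_list (e # fs) | fs. distinct fs \<and> set fs \<subseteq> set es - {e}})"
      using span_wedge_lists_avoiding[OF assms(2)] by blast
  next
    fix L assume "L \<in> {wedge_list fs | fs. distinct fs \<and> set fs \<subseteq> set es - {e}} \<union>
        {wedge_list (e # fs) | fs. distinct fs \<and> set fs \<subseteq> set es - {e}}"
    then obtain fs where "L = wedge_list fs \<or> L = wedge_list (e # fs)"
      and fs: "distinct (e # fs)" "set (e # fs) \<subseteq> set es" using \<open>e \<in> set es\<close> by auto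
    then show "g (vec_mv e) L = h (vec_mv e) L"
      using step[OF _ fs] square[OF _ fs] assms(3,4) by metis
  qed
  have list: "g (wedge_list fs) N = h (wedge_list fs) N"
    if "distinct fs" "set fs \<subseteq> set es" for fs N
    using that
  proof (induction fs)
    case Nil
    with assms(3,4) show ?case by (simp add: is_geometric_product_def)
  next
    case (Cons f fs)
    have rec: "k (wedge_list (f # fs)) N = k (vec_mv f) (k (wedge_list fs) N)"
      if k: "is_geometric_product k" for k
    proof -
      have "k (k (vec_mv f) (wedge_list fs)) N = k (vec_mv f) (k (wedge_list fs) N)"
        using k unfolding is_geometric_product_def by blast
      then show ?thesis by (simp only: step[OF k Cons.prems])
    qed
    from Cons vec show ?case by (simp add: rec[OF assms(3)] rec[OF assms(4)] del: wedge_list_Cons)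
  qed
  have "g M N = h M N" for M N
  proof (rule linear_eq_on[OF lin(2)[OF assms(3)] lin(2)[OF assms(4)], of M])
    show "M \<in> span {wedge_list fs | fs. distinct fs \<and> set fs \<subseteq> set es}"
      using span_distinct_wedge_lists[OF assms(2)] by blast
  qed (use list in auto)
  then show ?thesis by blast
qed

lemma geometric_product_eq:
  assumes "orthonormal es" "span (set es) = UNIV"
  shows "(\<^bold>\<cdot>) = clifford es"
  unfolding geometric_product_def
proof (rule the_equality)
  show "is_geometric_product (clifford es)" by (rule is_geometric_product_clifford[OF assms])
  then show "g = clifford es" if "is_geometric_product g" for g
    using geometric_product_unique[OF assms that] by blast
qed

section \<open>Multi-indices and their signs\<close>

lemma sorting_permutation_exists:
  fixes ks :: "nat list"
  assumes "distinct ks"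
  obtains \<pi> where "\<pi> permutes {..<length ks}" "sorted_wrt (<) (permute_list \<pi> ks)"
proof -
  obtain \<pi> where "\<pi> permutes {..<length ks}" "permute_list \<pi> ks = sort ks"
    by (rule mset_eq_permutation[of "sort ks" ks]) simp_all
  with assms that show thesis by (metis distinct_sort sorted_sort strict_sorted_iff)
qed

lemma sorting_permutation_unique:
  fixes ks :: "nat list"
  assumes "distinct ks"
    and \<pi>: "\<pi> permutes {..<length ks}" "sorted_wrt (<) (permute_list \<pi> ks)"
    and \<rho>: "\<rho> permutes {..<length ks}" "sorted_wrt (<) (permute_list \<rho> ks)"
  shows "\<pi> = \<rho>"
proof
  fix i
  have eq: "permute_list \<pi> ks = permute_list \<rho> ks"
    by (rule sorted_distinct_set_unique) (use assms in \<open>simp_all add: strict_sorted_iff\<close>)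
  show "\<pi> i = \<rho> i"
  proof (cases "i < length ks")
    case True
    then have "\<pi> i < length ks" "\<rho> i < length ks"
      using permutes_in_image[OF \<pi>(1)] permutes_in_image[OF \<rho>(1)] by auto
    moreover have "ks ! \<pi> i = ks ! \<rho> i"
      using eq True permute_list_nth[OF \<pi>(1)] permute_list_nth[OF \<rho>(1)] by metis
    ultimately show ?thesis using assms(1) by (simp add: nth_eq_iff_index_eq)
  next
    case False
    then show ?thesis using \<pi>(1) \<rho>(1) by (simp add: permutes_def)
  qed
qed

lemma sort_sign_eq:
  assumes "distinct ks" "\<pi> permutes {..<length ks}" "sorted_wrt (<) (permute_list \<pi> ks)"
  shows "sort_sign ks = sign \<pi>"
  unfolding sort_sign_def
  using assms sorting_permutation_unique by (intro arg_cong[of _ _ sign] the_equality) auto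

lemma sort_sign_Nil [simp]: "sort_sign [] = 1"
  using sort_sign_eq[of "[]" id] by (simp add: permutes_id)

text \<open>
  The permutation that sorts \<open>ks\<close> fixes all positions from \<open>length ks\<close> on, so it also sorts the longer
  list, and is literally the same function.
\<close>

lemma sort_sign_append_greatest:
  assumes "distinct ks" "\<And>k. k \<in> set ks \<Longrightarrow> k < m"
  shows "sort_sign (ks @ [m]) = sort_sign ks"
proof -
  obtain \<pi> where \<pi>: "\<pi> permutes {..<length ks}" "sorted_wrt (<) (permute_list \<pi> ks)"
    using sorting_permutation_exists[OF assms(1)] .
  have perm: "\<pi> permutes {..<length (ks @ [m])}"
    by (rule permutes_subset[OF \<pi>(1)]) auto
  have "permute_list \<pi> (ks @ [m]) = permute_list \<pi> ks @ [m]"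
  proof (rule nth_equalityI)
    fix i assume "i < length (permute_list \<pi> (ks @ [m]))"
    then consider "i < length ks" | "i = length ks" by fastforce
    then show "permute_list \<pi> (ks @ [m]) ! i = (permute_list \<pi> ks @ [m]) ! i"
    proof cases
      case 1
      then have "\<pi> i < length ks" using permutes_in_image[OF \<pi>(1)] by auto
      with 1 show ?thesis
        by (simp add: permute_list_nth[OF perm] permute_list_nth[OF \<pi>(1)] nth_append)
    next
      case 2
      then have "\<pi> i = i" using \<pi>(1) by (simp add: permutes_def)
      with 2 show ?thesis by (simp add: permute_list_nth[OF perm] nth_append)
    qed
  qed simp
  then have "sorted_wrt (<) (permute_list \<pi> (ks @ [m]))"
    using \<pi> assms(2) by (simp add: sorted_wrt_append)
  moreover have "distinct (ks @ [m])" using assms by auto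
  ultimately show ?thesis
    using sort_sign_eq[OF assms(1) \<pi>] sort_sign_eq[OF _ perm] by simp
qed

lemma sort_sign_swap:
  assumes "distinct (xs @ a # b # ys)"
  shows "sort_sign (xs @ a # b # ys) = - sort_sign (xs @ b # a # ys)"
proof -
  let ?ks = "xs @ a # b # ys" and ?ls = "xs @ b # a # ys" and ?n = "length xs"
  let ?\<tau> = "transpose ?n (Suc ?n)"
  have \<tau>: "?\<tau> permutes {..<length ?ks}" by (rule permutes_swap_id) auto
  have swap: "permute_list ?\<tau> ?ks = ?ls"
  proof (rule nth_equalityI)
    fix i assume i: "i < length (permute_list ?\<tau> ?ks)"
    consider "i < ?n" | "i = ?n" | "i = Suc ?n" | "i > Suc ?n" by linarith
    then show "permute_list ?\<tau> ?ks ! i = ?ls ! i"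
      using i by cases (auto simp: permute_list_nth[OF \<tau>] nth_append nth_Cons' transpose_def)
  qed simp
  have dist: "distinct ?ls" using assms by auto
  obtain \<pi> where \<pi>: "\<pi> permutes {..<length ?ls}" "sorted_wrt (<) (permute_list \<pi> ?ls)"
    using sorting_permutation_exists[OF dist] .
  have \<pi>': "\<pi> permutes {..<length ?ks}" using \<pi>(1) by simp
  have "sorted_wrt (<) (permute_list (?\<tau> \<circ> \<pi>) ?ks)"
    using \<pi>(2) by (simp only: permute_list_compose[OF \<pi>'] swap)
  then have "sort_sign ?ks = sign (?\<tau> \<circ> \<pi>)"
    by (rule sort_sign_eq[OF assms permutes_compose[OF \<pi>' \<tau>]])
  also have "\<dots> = sign ?\<tau> * sign \<pi>"
    using \<tau> \<pi>' by (intro sign_compose permutation_permutes[THEN iffD2]) auto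
  finally show ?thesis by (simp add: sign_swap_id sort_sign_eq[OF dist \<pi>])
qed

lemma sort_sign_move_to_end:
  "distinct (xs @ m # ys) \<Longrightarrow> sort_sign (xs @ m # ys) = (- 1) ^ length ys * sort_sign (xs @ ys @ [m])"
proof (induction ys arbitrary: xs)
  case (Cons y ys)
  have "sort_sign (xs @ m # y # ys) = - sort_sign ((xs @ [y]) @ m # ys)"
    using sort_sign_swap[OF Cons.prems] by simp
  also have "sort_sign ((xs @ [y]) @ m # ys) = (- 1) ^ length ys * sort_sign ((xs @ [y]) @ ys @ [m])"
    using Cons.prems by (intro Cons.IH) auto
  finally show ?case by simp
qed simp

lemma multi_indices_0: "multi_indices 0 = {[]}"
  by (auto simp: multi_indices_def)

lemma finite_multi_indices: "finite (multi_indices p)"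
proof (rule finite_subset)
  show "multi_indices p \<subseteq> {is. set is \<subseteq> {1..p} \<and> distinct is}"
    by (auto simp: multi_indices_def strict_sorted_iff)
  show "finite {is. set is \<subseteq> {1..p} \<and> distinct is}"
    by (rule finite_subset_distinct) simp
qed

text \<open>
  A multi-index in \<open>{1..Suc p}\<close> omits \<open>Suc p\<close> or ends with it. This splits every sum over multi-indices
  in two, according to whether \<open>Suc p\<close> belongs to the complement or to the index.
\<close>

lemma multi_indices_Suc:
  "multi_indices (Suc p) = multi_indices p \<union> (\<lambda>is. is @ [Suc p]) ` multi_indices p"
proof (intro equalityI subsetI)
  fix "is" assume "is": "is \<in> multi_indices (Suc p)"
  show "is \<in> multi_indices p \<union> (\<lambda>is. is @ [Suc p]) ` multi_indices p"
  proof (cases "Suc p \<in> set is")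
    case False
    with "is" have "is \<in> multi_indices p"
      by (auto simp: multi_indices_def subset_iff) (metis le_SucE)
    then show ?thesis ..
  next
    case True
    then obtain js ks where js: "is = js @ Suc p # ks" by (auto simp: in_set_conv_decomp)
    with "is" have less: "\<forall>k\<in>set ks. Suc p < k" and bound: "set ks \<subseteq> {1..Suc p}"
      by (auto simp: multi_indices_def sorted_wrt_append)
    have "ks = []"
    proof (rule ccontr)
      assume "ks \<noteq> []"
      then have "hd ks \<in> set ks" by simp
      with less bound have "Suc p < hd ks" "hd ks \<le> Suc p" by auto
      then show False by simp
    qed
    with js "is" have "js \<in> multi_indices p"
      by (force simp: multi_indices_def sorted_wrt_append)
    with js \<open>ks = []\<close> show ?thesis by blast
  qed
qed (auto simp: multi_indices_def sorted_wrt_append subset_iff less_Suc_eq_le le_Suc_eq)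

lemma mi_compl_Suc:
  assumes "is \<in> multi_indices p"
  shows "mi_compl (Suc p) is = mi_compl p is @ [Suc p]"
proof -
  have "{1..Suc p} - set is = insert (Suc p) ({1..p} - set is)"
    using assms by (auto simp: multi_indices_def)
  moreover have "sorted_list_of_set (insert (Suc p) ({1..p} - set is)) = mi_compl p is @ [Suc p]"
    by (rule sorted_list_of_set_unique[THEN iffD1])
       (auto simp: mi_compl_def sorted_wrt_append card_Diff_subset)
  ultimately show ?thesis by (simp add: mi_compl_def)
qed

lemma mi_compl_Suc_append: "mi_compl (Suc p) (is @ [Suc p]) = mi_compl p is"
  by (auto simp: mi_compl_def intro!: arg_cong[of _ _ sorted_list_of_set])

lemma distinct_mi_compl:
  assumes "is \<in> multi_indices p"
  shows "distinct (is @ mi_compl p is)" "set (is @ mi_compl p is) = {1..p}"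
  using assms by (auto simp: multi_indices_def mi_compl_def strict_sorted_iff)

lemma sort_sign_Suc:
  assumes "is \<in> multi_indices p"
  shows "sort_sign (is @ mi_compl p is @ [Suc p]) = sort_sign (is @ mi_compl p is)" (is ?last)
    and "sort_sign (is @ Suc p # mi_compl p is) =
      (- 1) ^ length (mi_compl p is) * sort_sign (is @ mi_compl p is)"
proof -
  show ?last
    using sort_sign_append_greatest[OF distinct_mi_compl(1)[OF assms], of "Suc p"]
    unfolding distinct_mi_compl(2)[OF assms] by simp
  have "Suc p \<notin> set (is @ mi_compl p is)"
    unfolding distinct_mi_compl(2)[OF assms] by simp
  then have "distinct (is @ Suc p # mi_compl p is)"
    using distinct_mi_compl(1)[OF assms] by simp
  from sort_sign_move_to_end[OF this]
  show "sort_sign (is @ Suc p # mi_compl p is) =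
      (- 1) ^ length (mi_compl p is) * sort_sign (is @ mi_compl p is)"
    unfolding \<open>?last\<close> .
qed

lemma sum_multi_indices_Suc:
  "(\<Sum>is\<in>multi_indices (Suc p). f is) =
     (\<Sum>is\<in>multi_indices p. f is + f (is @ [Suc p]))"
proof -
  have "multi_indices p \<inter> (\<lambda>is. is @ [Suc p]) ` multi_indices p = {}"
    by (auto simp: multi_indices_def)
  moreover have "inj_on (\<lambda>is. is @ [Suc p]) (multi_indices p)" by (auto simp: inj_on_def)
  ultimately show ?thesis
    by (simp add: multi_indices_Suc sum.union_disjoint finite_multi_indices sum.reindex sum.distrib)
qed

section \<open>Expansion over multi-indices\<close>

lemma involute_funpow_interior:
  "(involute ^^ k) (interior u M) = (- 1) ^ k *\<^sub>R interior u ((involute ^^ k) M)"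
  by (induction k) simp_all

lemma wedge_mi_append: "wedge_mi v (is @ js) = wedge_mi v is \<^bold>\<and> wedge_mi v js"
  by (simp add: wedge_mi_def wedge_list_append)

lemma wedge_mi_singleton: "wedge_mi v [i] = vec_mv (v i)"
  by (simp add: wedge_mi_def wedge_one)

context graded_product
begin

text \<open>
  Contracting by \<open>v\<^sub>1 \<and> \<dots> \<and> v\<^sub>p \<and> u\<close> is contracting by \<open>v\<^sub>1 \<and> \<dots> \<and> v\<^sub>p\<close> and then by \<open>u = v (Suc p)\<close>. Each
  summand indexed by \<open>is\<close> splits: when \<open>u\<close> acts on the left factor, \<open>Suc p\<close> joins the complement; when it
  acts on the right factor, \<open>Suc p\<close> joins \<open>is\<close>. In the second case the involution of the left factor
  yields \<open>(- 1) ^ length (mi_compl p is)\<close>, which is the sign of moving \<open>Suc p\<close> across the complement.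
\<close>

lemma contract_wedge_mi_prod:
  "contract (wedge_mi v [1..<Suc p]) (M \<star> N) =
    (\<Sum>is\<in>multi_indices p. of_int (sort_sign (is @ mi_compl p is)) *\<^sub>R
      (contract (wedge_mi v (mi_compl p is)) ((involute ^^ length is) M)
        \<star> contract (wedge_mi v is) N))"
proof (induction p)
  case 0
  show ?case by (simp add: multi_indices_0 mi_compl_def wedge_mi_def)
next
  case (Suc p)
  let ?s = "\<lambda>is. of_int (sort_sign (is @ mi_compl p is)) :: real"
  let ?M = "\<lambda>is. contract (wedge_mi v (mi_compl p is)) ((involute ^^ length is) M)"
  let ?N = "\<lambda>is. contract (wedge_mi v is) N"
  let ?u = "v (Suc p)"
  let ?t = "\<lambda>q is. of_int (sort_sign (is @ mi_compl q is)) *\<^sub>R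
      (contract (wedge_mi v (mi_compl q is)) ((involute ^^ length is) M)
        \<star> contract (wedge_mi v is) N)"
  have inv: "involute (?M is) = (- 1) ^ length (mi_compl p is) *\<^sub>R
      contract (wedge_mi v (mi_compl p is)) ((involute ^^ length (is @ [Suc p])) M)" for "is"
    by (simp add: wedge_mi_def involute_contract_wedge_list)
  have "contract (wedge_mi v [1..<Suc (Suc p)]) (M \<star> N) =
      interior ?u (contract (wedge_mi v [1..<Suc p]) (M \<star> N))"
    by (simp add: wedge_mi_append wedge_mi_singleton)
  also have "\<dots> = (\<Sum>is\<in>multi_indices p. ?s is *\<^sub>R
      (interior ?u (?M is) \<star> ?N is + involute (?M is) \<star> interior ?u (?N is)))"
    by (simp only: Suc linear_sum[OF linear_interior] interior_scaleR interior_prod)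
  also have "\<dots> = (\<Sum>is\<in>multi_indices p. ?t (Suc p) is + ?t (Suc p) (is @ [Suc p]))"
    by (rule sum.cong[OF HOL.refl])
       (simp add: sort_sign_Suc inv mi_compl_Suc mi_compl_Suc_append wedge_mi_append wedge_mi_singleton prod_simps
          scaleR_add_right mult.commute)
  finally show ?case by (simp only: sum_multi_indices_Suc)
qed

text \<open>
  Here the innermost vector \<open>u = v (Suc p)\<close> acts first, so the induction hypothesis is needed for
  both \<open>(involute M, u \<and> N)\<close> and \<open>(interior u M, N)\<close>. In the second case the contraction by \<open>u\<close>
  precedes the one by the multi-index, although \<open>u\<close> comes last in the extended multi-index; this is why
  reversion appears. Moving \<open>interior u\<close> past the involutions yields the sign.
\<close>

lemma wedge_mi_wedge_prod:
  assumes vec: "\<And>u M N. vec_mv u \<^bold>\<and> (M \<star> N) = involute M \<star> (vec_mv u \<^bold>\<and> N) + interior u M \<star> N"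
  shows "wedge_mi v [1..<Suc p] \<^bold>\<and> (M \<star> N) =
    (\<Sum>is\<in>multi_indices p. of_int (sort_sign (is @ mi_compl p is)) *\<^sub>R
      (contract (reverse (wedge_mi v is)) ((involute ^^ length (mi_compl p is)) M)
        \<star> (wedge_mi v (mi_compl p is) \<^bold>\<and> N)))"
proof (induction p arbitrary: M N)
  case 0
  show ?case by (simp add: multi_indices_0 mi_compl_def wedge_mi_def wedge_one)
next
  case (Suc p)
  let ?u = "v (Suc p)"
  let ?t = "\<lambda>q M N is. of_int (sort_sign (is @ mi_compl q is)) *\<^sub>R
      (contract (reverse (wedge_mi v is)) ((involute ^^ length (mi_compl q is)) M)
        \<star> (wedge_mi v (mi_compl q is) \<^bold>\<and> N))"
  have "wedge_mi v [1..<Suc (Suc p)] \<^bold>\<and> (M \<star> N) =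
      wedge_mi v [1..<Suc p] \<^bold>\<and> (involute M \<star> (vec_mv ?u \<^bold>\<and> N)) +
      wedge_mi v [1..<Suc p] \<^bold>\<and> (interior ?u M \<star> N)"
    by (simp add: wedge_mi_append wedge_mi_singleton wedge_assoc vec wedge_simps)
  also have "\<dots> = (\<Sum>is\<in>multi_indices p.
      ?t p (involute M) (vec_mv ?u \<^bold>\<and> N) is + ?t p (interior ?u M) N is)"
    by (simp only: Suc sum.distrib)
  also have "\<dots> = (\<Sum>is\<in>multi_indices p. ?t (Suc p) M N is + ?t (Suc p) M N (is @ [Suc p]))"
    by (rule sum.cong[OF HOL.refl])
       (simp add: sort_sign_Suc mi_compl_Suc mi_compl_Suc_append wedge_mi_append wedge_mi_singleton prod_simps
          wedge_assoc funpow_swap1 involute_funpow_interior)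
  finally show ?case by (simp only: sum_multi_indices_Suc)
qed

end

theorem theorem3p48:
  fixes v :: "nat \<Rightarrow> 'a::real_inner" and p :: nat and M N :: "'a multivector"
  assumes finite_dim: "\<exists>B::'a set. finite B \<and> span B = UNIV"
  shows "wedge_mi v [1..<Suc p] \<^bold>\<rfloor> (M \<^bold>\<cdot> N) =
      (\<Sum>is\<in>multi_indices p. of_int (sort_sign (is @ mi_compl p is)) *\<^sub>R
        ((wedge_mi v (mi_compl p is) \<^bold>\<rfloor> (grade_involution ^^ length is) M)
          \<^bold>\<cdot> (wedge_mi v is \<^bold>\<rfloor> N)))
    \<and> wedge_mi v [1..<Suc p] \<^bold>\<and> (M \<^bold>\<cdot> N) =
      (\<Sum>is\<in>multi_indices p. of_int (sort_sign (is @ mi_compl p is)) *\<^sub>R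
        ((reversion (wedge_mi v is) \<^bold>\<rfloor> (grade_involution ^^ length (mi_compl p is)) M)
          \<^bold>\<cdot> (wedge_mi v (mi_compl p is) \<^bold>\<and> N)))"
proof -
  obtain es where es: "orthonormal es" "span (set es) = (UNIV :: 'a set)"
    using finite_dim orthonormal_spanning_list_exists by metis
  interpret graded_product "clifford es" by (rule graded_product_clifford)
  have vec: "vec_mv u \<^bold>\<and> clifford es M N =
      clifford es (involute M) (vec_mv u \<^bold>\<and> N) + clifford es (interior u M) N" for u M N
    by (simp add: vec_mv_wedge_clifford orthonormal_expansion es)
  show ?thesis
    unfolding geometric_product_eq[OF es] left_contraction_eq[OF es] grade_involution_eq reversion_eq
    by (intro conjI contract_wedge_mi_prod wedge_mi_wedge_prod[OF vec])
qed

end
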